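(* Let $\mathbf{s}_0$ be a binary sequence of even period $N$, and let $\mathbf{s}_1$ be either $L^{N/2}(\mathbf{s}_0)$ or $L^{N/2}(\overline{\mathbf{s}}_0)$. Define the quaternary sequence $\mathbf{u}$ of period $N$ by $u(t)=\phi^{-1}(s_0(t),s_1(t))$. Then $R_{\mathbf{u}}(\tau)=R_{\mathbf{s}_0}(\tau)$ for all $0\le\tau<N$. Moreover \[N_0(\mathbf{u})=|\overline{D}_{\mathbf{s}_0}\cap\overline{D}_{\mathbf{s}_1}|,\quad N_1(\mathbf{u})=|\overline{D}_{\mathbf{s}_0}\cap D_{\mathbf{s}_1}|,\quad N_2(\mathbf{u})=|D_{\mathbf{s}_0}\cap D_{\mathbf{s}_1}|,\quad N_3(\mathbf{u})=|D_{\mathbf{s}_0}\cap \overline{D}_{\mathbf{s}_1}|.\]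
   Context: For a sequence $\mathbf{s}=(s(t))$ of period $N$ over $\mathbb{Z}_m$, $N_k(\mathbf{s})=|\{0\le t<N: s(t)=k\}|$ and $R_{\mathbf{s}}(\tau)=\sum_{t=0}^{N-1}\omega^{s(t)-s(t+\tau)}$ with $\omega=e^{2\pi\sqrt{-1}/m}$ and indices modulo $N$ (so $\omega=-1$ for binary and $\omega=\sqrt{-1}$ for quaternary sequences). $L^{\tau}$ is the left cyclic shift: $L^{\tau}(\mathbf{s})=(s(t+\tau))_t$. $\overline{\mathbf{s}}$ is the complement of a binary sequence ($\overline{s}(t)=1-s(t)$). For a binary sequence $\mathbf{s}$, $D_{\mathbf{s}}=\{t\in\mathbb{Z}_N: s(t)=1\}$ is its support and $\overline{D}_{\mathbf{s}}=\mathbb{Z}_N\setminus D_{\mathbf{s}}$. $\phi:\mathbb{Z}_4\to\mathbb{Z}_2\times\mathbb{Z}_2$ is the Gray map $\phi(0)=(0,0),\phi(1)=(0,1),\phi(2)=(1,1),\phi(3)=(1,0)$. *)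

theory Defs
  imports Complex_Main
begin

text \<open>
  Residues modulo m are represented by the integers in \<open>{0..<m}\<close>. A sequence of period N is a
  function on the natural numbers that repeats with period N (not necessarily the least one), so
  index arithmetic modulo N is just addition; \<open>{0..<N}\<close> plays the role of the index set
  of integers modulo N.
\<close>

definition seq_over :: "nat \<Rightarrow> nat \<Rightarrow> (nat \<Rightarrow> int) \<Rightarrow> bool" where
  "seq_over m N s \<longleftrightarrow> N > 0 \<and> (\<forall>t. s t \<in> {0..<int m}) \<and> (\<forall>t. s (t + N) = s t)"

definition count_value :: "nat \<Rightarrow> int \<Rightarrow> (nat \<Rightarrow> int) \<Rightarrow> nat" where
  "count_value N k s = card {t \<in> {0..<N}. s t = k}"

definition omega :: "nat \<Rightarrow> complex" where
  "omega m = exp (2 * of_real pi * \<i> / of_nat m)"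

text \<open>The exponent \<open>s t - s (t + \<tau>)\<close> may be negative as an integer, hence the integer power;
  as \<open>omega m\<close> is an m-th root of unity, only its residue modulo m matters.\<close>

definition autocorrelation :: "nat \<Rightarrow> nat \<Rightarrow> (nat \<Rightarrow> int) \<Rightarrow> nat \<Rightarrow> complex" where
  "autocorrelation m N s \<tau> = (\<Sum>t = 0..<N. omega m powi (s t - s (t + \<tau>)))"

definition left_shift :: "nat \<Rightarrow> (nat \<Rightarrow> int) \<Rightarrow> nat \<Rightarrow> int" where
  "left_shift \<tau> s = (\<lambda>t. s (t + \<tau>))"

definition complement_seq :: "(nat \<Rightarrow> int) \<Rightarrow> nat \<Rightarrow> int" where
  "complement_seq s = (\<lambda>t. 1 - s t)"

definition support :: "nat \<Rightarrow> (nat \<Rightarrow> int) \<Rightarrow> nat set" where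
  "support N s = {t \<in> {0..<N}. s t = 1}"

definition cosupport :: "nat \<Rightarrow> (nat \<Rightarrow> int) \<Rightarrow> nat set" where
  "cosupport N s = {0..<N} - support N s"

text \<open>Only the values on \<open>{0..<4}\<close> are meaningful.\<close>

definition gray_map :: "int \<Rightarrow> int \<times> int" where
  "gray_map k = (if k = 0 then (0, 0) else if k = 1 then (0, 1)
                 else if k = 2 then (1, 1) else (1, 0))"

definition gray_inv :: "int \<times> int \<Rightarrow> int" where
  "gray_inv = the_inv_into {0..<4} gray_map"

lemma bij_betw_gray_map: "bij_betw gray_map {0..<4} ({0..<2} \<times> {0..<2})"
proof -
  have 4: "{0..<4} = {0, 1, 2, 3 :: int}" and 2: "{0..<2} = {0, 1 :: int}" by auto
  show ?thesis unfolding 4 2 by (auto simp: bij_betw_def inj_on_def gray_map_def)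
qed

lemma seq_over_gray_inv:
  assumes "seq_over 2 N a" "seq_over 2 N b"
  shows "seq_over 4 N (\<lambda>t. gray_inv (a t, b t))"
proof -
  have "gray_inv (a t, b t) \<in> {0..<4}" for t
    using bij_betwE[OF bij_betw_the_inv_into[OF bij_betw_gray_map]] assms
    by (auto simp: gray_inv_def seq_over_def)
  then show ?thesis using assms by (auto simp: seq_over_def)
qed

lemma seq_over_left_shift: "seq_over m N s \<Longrightarrow> seq_over m N (left_shift \<tau> s)"
  by (auto simp: seq_over_def left_shift_def) (metis add.assoc add.commute)

lemma seq_over_complement_seq: "seq_over 2 N s \<Longrightarrow> seq_over 2 N (complement_seq s)"
proof -
  assume s: "seq_over 2 N s"
  then have "s t \<in> {0..<2}" for t by (simp add: seq_over_def)
  then have "1 - s t \<in> {0..<2}" for t by (smt (verit) atLeastLessThan_iff)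
  with s show ?thesis by (simp add: seq_over_def complement_seq_def)
qed

end

theory Submission
  imports Defs
begin

text \<open>
  Write \<open>a t = (-1)^(s0 t)\<close> and \<open>b t = (-1)^(s1 t)\<close>. The Gray map satisfies
  \<open>i^(u t) = ((1 + i) a t + (1 - i) b t) / 2\<close>, so the autocorrelation of \<open>u\<close> is half the
  sum of those of \<open>s0\<close> and \<open>s1\<close> plus \<open>i/2\<close> times the difference of the two
  cross-correlations. As \<open>s1\<close> is a shift of \<open>s0\<close> up to complement, both autocorrelations
  agree; as the shift is by half a period, the cross-correlations agree and cancel.
\<close>

text \<open>Induction on the shift: the window of \<open>N + 1\<close> terms starting at
  \<open>h\<close> loses either its first term \<open>f h\<close> or its last term
  \<open>f (N + h)\<close>. These agree by periodicity, and cancelling them in the group leaves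
  equal sums.\<close>

lemma sum_shift_periodic:
  fixes f :: "nat \<Rightarrow> 'a::ab_group_add"
  assumes "\<And>t. f (t + N) = f t"
  shows "(\<Sum>t = 0..<N. f (t + h)) = (\<Sum>t = 0..<N. f t)"
proof (induction h)
  case (Suc h)
  have "(\<Sum>t = 0..<N. f (Suc t + h)) + f h = (\<Sum>t = 0..<Suc N. f (t + h))"
    by (simp only: sum.atLeast0_lessThan_Suc_shift o_def) (simp add: add.commute)
  also have "\<dots> = (\<Sum>t = 0..<N. f (t + h)) + f h"
    using assms[of h] by (simp add: add.commute)
  finally show ?case using Suc by simp
qed simp

lemma omega_2: "omega 2 = -1"
  by (simp add: omega_def exp_eq_polar)

lemma omega_4: "omega 4 = \<i>"
proof -
  have "omega 4 = cis (pi / 2)"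
    unfolding omega_def cis_conv_exp by (simp add: field_simps)
  then show ?thesis by simp
qed

lemma gray_inv_simps:
  "gray_inv (0, 0) = 0" "gray_inv (0, 1) = 1" "gray_inv (1, 1) = 2" "gray_inv (1, 0) = 3"
proof -
  have "gray_inv (gray_map k) = k" if "k \<in> {0..<4}" for k
    unfolding gray_inv_def
    using bij_betw_gray_map that by (simp add: bij_betw_def the_inv_into_f_f)
  from this[of 0] this[of 1] this[of 2] this[of 3]
  show "gray_inv (0, 0) = 0" "gray_inv (0, 1) = 1" "gray_inv (1, 1) = 2" "gray_inv (1, 0) = 3"
    by (simp_all add: gray_map_def)
qed

lemma seq_over_2_cases:
  assumes "seq_over 2 N s"
  shows "s t = 0 \<or> s t = 1"
proof -
  have "s t \<in> {0..<2}" using assms by (simp add: seq_over_def)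
  then show ?thesis by auto
qed

text \<open>This is (-1)^x for a bit x. In the affine form, complementing the bit is visibly a
  negation.\<close>

abbreviation sign :: "int \<Rightarrow> complex" where
  "sign x \<equiv> of_int (1 - 2 * x)"

text \<open>A sign is its own inverse, so the difference in the exponent becomes a product.\<close>

lemma omega_2_powi_diff:
  assumes "x = 0 \<or> x = 1" "y = 0 \<or> y = 1"
  shows "omega 2 powi (x - y) = sign x * sign y"
  using assms by (auto simp: omega_2 power_int_minus)

lemma omega_4_powi_gray_inv:
  assumes "x = 0 \<or> x = 1" "y = 0 \<or> y = 1"
  shows "omega 4 powi gray_inv (x, y) = ((1 + \<i>) * sign x + (1 - \<i>) * sign y) / 2"
  using assms
  by (auto simp: omega_4 gray_inv_simps power3_eq_cube field_simps)

text \<open>The complex conjugate of the preceding formula: on the unit circle inversion is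
  conjugation, and the signs are real.\<close>

lemma omega_4_powi_minus_gray_inv:
  assumes "x = 0 \<or> x = 1" "y = 0 \<or> y = 1"
  shows "omega 4 powi (- gray_inv (x, y)) = ((1 - \<i>) * sign x + (1 + \<i>) * sign y) / 2"
  using assms
  by (auto simp: omega_4 gray_inv_simps power_int_minus power3_eq_cube field_simps)

lemma omega_4_powi_gray_inv_diff:
  assumes "x = 0 \<or> x = 1" "y = 0 \<or> y = 1" "x' = 0 \<or> x' = 1" "y' = 0 \<or> y' = 1"
  shows "omega 4 powi (gray_inv (x, y) - gray_inv (x', y')) =
    (sign x * sign x' + sign y * sign y') / 2 + \<i> / 2 * (sign x * sign y' - sign y * sign x')"
proof -
  have "omega 4 powi (gray_inv (x, y) - gray_inv (x', y')) =
      omega 4 powi gray_inv (x, y) * omega 4 powi (- gray_inv (x', y'))"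
    using power_int_add[of "omega 4" "gray_inv (x, y)" "- gray_inv (x', y')"]
    by (simp add: omega_4)
  also have "\<dots> = (sign x * sign x' + sign y * sign y') / 2
      + \<i> / 2 * (sign x * sign y' - sign y * sign x')"
    \<comment> \<open>Expanding uses (1 + \<i>)(1 - \<i>) = 2 and (1 + \<i>)^2 = 2\<i> = -(1 -
      \<i>)^2.\<close>
    unfolding omega_4_powi_gray_inv[OF assms(1,2)] omega_4_powi_minus_gray_inv[OF assms(3,4)]
    by (simp add: field_simps)
  finally show ?thesis .
qed

text \<open>The factor \<open>\<epsilon>\<close> treats both choices of \<open>s1\<close> at once:
  it is 1 for the plain shift and -1 for the complemented one.\<close>

lemma autocorrelation_gray_inv:
  assumes s0: "seq_over 2 N s0" and s1: "seq_over 2 N s1"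
    and even: "even N"
    and eps: "\<epsilon> * \<epsilon> = 1" "\<And>t. sign (s1 t) = \<epsilon> * sign (s0 (t + N div 2))"
  shows "autocorrelation 4 N (\<lambda>t. gray_inv (s0 t, s1 t)) \<tau> = autocorrelation 2 N s0 \<tau>"
proof -
  define a where "a t = sign (s0 t)" for t
  define b where "b t = sign (s1 t)" for t
  define h where "h = N div 2"
  have N: "N = h + h" using even by (auto simp: h_def)
  have b: "b t = \<epsilon> * a (t + h)" for t
    using eps(2) by (simp add: a_def b_def h_def)
  have per: "a (t + N) = a t" for t
    using s0 by (simp add: a_def seq_over_def)
  have per': "a (t + N + k) = a (t + k)" for t k
    using per[of "t + k"] by (simp add: add_ac)
  have R0: "autocorrelation 2 N s0 \<tau> = (\<Sum>t = 0..<N. a t * a (t + \<tau>))"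
    unfolding autocorrelation_def a_def
    by (intro sum.cong refl omega_2_powi_diff seq_over_2_cases[OF s0])
  have bb: "(\<Sum>t = 0..<N. b t * b (t + \<tau>)) = (\<Sum>t = 0..<N. a t * a (t + \<tau>))"
  proof -
    \<comment> \<open>The two factors \<open>\<epsilon>\<close> multiply to 1, leaving the summand
      for \<open>s0\<close> shifted by \<open>h\<close>.\<close>
    have "b t * b (t + \<tau>) = a (t + h) * a (t + h + \<tau>)" for t
    proof -
      have "b t * b (t + \<tau>) = (\<epsilon> * \<epsilon>) * (a (t + h) * a (t + h + \<tau>))"
        by (simp add: b add_ac mult_ac)
      then show ?thesis by (simp add: eps(1))
    qed
    then show ?thesis
      using sum_shift_periodic[of "\<lambda>t. a t * a (t + \<tau>)" N h] by (simp add: per per')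
  qed
  have cross: "(\<Sum>t = 0..<N. b t * a (t + \<tau>)) = (\<Sum>t = 0..<N. a t * b (t + \<tau>))"
  proof -
    have "(\<Sum>t = 0..<N. b t * a (t + \<tau>)) = (\<Sum>t = 0..<N. b (t + h) * a (t + h + \<tau>))"
      using sum_shift_periodic[of "\<lambda>t. b t * a (t + \<tau>)" N h] by (simp add: b per per')
    also have "\<dots> = (\<Sum>t = 0..<N. a t * b (t + \<tau>))"
    proof (intro sum.cong refl)
      fix t
      \<comment> \<open>Here the half period matters: two shifts by \<open>h\<close> make a full
        period, so \<open>a\<close> and \<open>b\<close> swap roles up to the same factor
        \<open>\<epsilon>\<close>.\<close>
      have bt: "b (t + h) = \<epsilon> * a t"
        using per[of t] by (simp add: b N add_ac)
      then show "b (t + h) * a (t + h + \<tau>) = a t * b (t + \<tau>)"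
        unfolding bt b[of "t + \<tau>"] by (simp add: add_ac)
    qed
    finally show ?thesis .
  qed
  have "autocorrelation 4 N (\<lambda>t. gray_inv (s0 t, s1 t)) \<tau> =
      (\<Sum>t = 0..<N. (a t * a (t + \<tau>) + b t * b (t + \<tau>)) / 2
        + \<i> / 2 * (a t * b (t + \<tau>) - b t * a (t + \<tau>)))"
    unfolding autocorrelation_def a_def b_def
    by (intro sum.cong refl omega_4_powi_gray_inv_diff
        seq_over_2_cases[OF s0] seq_over_2_cases[OF s1])
  also have "\<dots> = ((\<Sum>t = 0..<N. a t * a (t + \<tau>)) + (\<Sum>t = 0..<N. b t * b (t + \<tau>))) / 2
      + \<i> / 2 * ((\<Sum>t = 0..<N. a t * b (t + \<tau>)) - (\<Sum>t = 0..<N. b t * a (t + \<tau>)))"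
    by (simp only: sum.distrib sum_subtractf sum_distrib_left[symmetric] sum_divide_distrib[symmetric])
  also have "\<dots> = autocorrelation 2 N s0 \<tau>"
    by (simp add: bb cross R0)
  finally show ?thesis .
qed

lemma count_value_gray_inv:
  assumes "seq_over 2 N s0" "seq_over 2 N s1"
  defines "u \<equiv> \<lambda>t. gray_inv (s0 t, s1 t)"
  shows "count_value N 0 u = card (cosupport N s0 \<inter> cosupport N s1)"
    and "count_value N 1 u = card (cosupport N s0 \<inter> support N s1)"
    and "count_value N 2 u = card (support N s0 \<inter> support N s1)"
    and "count_value N 3 u = card (support N s0 \<inter> cosupport N s1)"
proof -
  \<comment> \<open>The bit 0 is expressed as \<open>\<noteq> 1\<close> because
    \<open>cosupport\<close> is the set difference with \<open>support\<close>; the remaining set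
    equalities are then pure logic.\<close>
  have u: "u t = 0 \<longleftrightarrow> s0 t \<noteq> 1 \<and> s1 t \<noteq> 1" "u t = 1 \<longleftrightarrow> s0 t \<noteq> 1 \<and> s1 t = 1"
    "u t = 2 \<longleftrightarrow> s0 t = 1 \<and> s1 t = 1" "u t = 3 \<longleftrightarrow> s0 t = 1 \<and> s1 t \<noteq> 1" for t
    using seq_over_2_cases[OF assms(1), of t] seq_over_2_cases[OF assms(2), of t]
    by (auto simp: u_def gray_inv_simps)
  show "count_value N 0 u = card (cosupport N s0 \<inter> cosupport N s1)"
    and "count_value N 1 u = card (cosupport N s0 \<inter> support N s1)"
    and "count_value N 2 u = card (support N s0 \<inter> support N s1)"
    and "count_value N 3 u = card (support N s0 \<inter> cosupport N s1)"
    unfolding count_value_def cosupport_def support_def u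
    by (rule arg_cong[of _ _ card], blast)+
qed

theorem theorem3:
  fixes N :: nat and s0 s1 u :: "nat \<Rightarrow> int"
  assumes "even N"
    and "seq_over 2 N s0"
    and "s1 = left_shift (N div 2) s0 \<or> s1 = left_shift (N div 2) (complement_seq s0)"
    and "u = (\<lambda>t. gray_inv (s0 t, s1 t))"
  shows "(\<forall>\<tau><N. autocorrelation 4 N u \<tau> = autocorrelation 2 N s0 \<tau>)
    \<and> count_value N 0 u = card (cosupport N s0 \<inter> cosupport N s1)
    \<and> count_value N 1 u = card (cosupport N s0 \<inter> support N s1)
    \<and> count_value N 2 u = card (support N s0 \<inter> support N s1)
    \<and> count_value N 3 u = card (support N s0 \<inter> cosupport N s1)"
proof -
  have s1: "seq_over 2 N s1"
    using assms(2,3) by (auto intro: seq_over_left_shift seq_over_complement_seq)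
  obtain \<epsilon> :: complex where eps: "\<epsilon> * \<epsilon> = 1" "\<And>t. sign (s1 t) = \<epsilon> * sign (s0 (t + N div 2))"
    using assms(3)
  proof
    assume "s1 = left_shift (N div 2) s0"
    then show thesis by (intro that[of 1]) (simp_all add: left_shift_def)
  next
    assume "s1 = left_shift (N div 2) (complement_seq s0)"
    \<comment> \<open>Replacing x by 1 - x turns 1 - 2x into its negative.\<close>
    then show thesis by (intro that[of "-1"]) (simp_all add: left_shift_def complement_seq_def)
  qed
  show ?thesis
    unfolding assms(4)
    using autocorrelation_gray_inv[OF assms(2) s1 assms(1) eps]
      count_value_gray_inv[OF assms(2) s1] by blast
qed

end
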